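(* Let $a_0=0.512967071402\ldots$. Then $$\mathcal{L}(n,a)+\gamma<H_n<\mathcal{L}(n,a)+c_1(a)$$ holds for all $n\in\mathbb{N}$ and $a\in(1/15,a_0)$, where $c_1(a)=1-\mathcal{L}(1,a)$ and $\gamma$ are the best possible. In particular, taking $a=1/2$, we have $$\frac{2}{49}\ln\left(n^2+n+\frac56\right)+\frac{45}{98}\ln\left(n^2+n+\frac{13}{45}\right)+\gamma<H_n<\frac{2}{49}\ln\left(n^2+n+\frac56\right)+\frac{45}{98}\ln\left(n^2+n+\frac{13}{45}\right)+c_1(1/2),$$ where $$c_1(1/2)=1-\frac{2}{49}\ln\frac{17}{6}-\frac{45}{98}\ln\frac{103}{45}\approx 0.57726.$$
   Context: $\mathbb{N}=\{1,2,3,\ldots\}$, $H_n=\sum_{k=1}^n\frac1k$ is the $n$-th harmonic number, and $\gamma=0.5772\ldots$ is the Euler–Mascheroni constant. For $x\ge0$ and $a>1/15$, $$\mathcal{L}(x,a)=\frac{1}{90a^{2}+2}\ln\left(x^{2}+x+\frac{3a+1}{3}\right)+\frac{45a^{2}}{90a^{2}+2}\ln\left(x^{2}+x+\frac{15a-1}{45a}\right).$$ The number $a_0$ is the unique root on $(1/15,\infty)$ of the equation (in $a$) $\psi(1)-\mathcal{L}(0,a)=0$, where $\psi=\Gamma'/\Gamma$ is the digamma function.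
   Formalization: The strict upper bound fails at n=1, where L(1,a)+c_1(a)=1=H_1; the upper bound (also for a=1/2) is therefore stated as ≤ for all n≥1 and as strict for every n≥2. *)

theory Defs
  imports "HOL-Analysis.Analysis"
begin

text \<open>Only meaningful for \<open>x \<ge> 0\<close> and \<open>a > 1/15\<close>, where both logarithms have positive arguments.\<close>

definition L :: "real \<Rightarrow> real \<Rightarrow> real" where
  "L x a = 1 / (90 * a^2 + 2) * ln (x^2 + x + (3 * a + 1) / 3)
         + 45 * a^2 / (90 * a^2 + 2) * ln (x^2 + x + (15 * a - 1) / (45 * a))"

definition a0 :: real where
  "a0 = (THE a. a > 1 / 15 \<and> Digamma 1 - L 0 a = 0)"

definition c1 :: "real \<Rightarrow> real" where
  "c1 a = 1 - L 1 a"

text \<open>Since \<open>H\<^sub>1 = 1\<close>, the upper bound for the harmonic numbers is attained at \<open>n = 1\<close>,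
  so it cannot be strict there.\<close>

lemma upper_bound_attained: "harm 1 = L (real 1) a + c1 a"
  by (simp add: c1_def harm_def)

end

theory Submission
  imports Defs "HOL-Real_Asymp.Real_Asymp"
begin

text \<open>
  Put \<open>D n = harm n - L n a\<close>. Since \<open>L x a = ln x + o(1)\<close>, the sequence \<open>D\<close> tends to
  \<open>euler_mascheroni\<close>, and \<open>D 1 = c1 a\<close>. All the inequalities, and the optimality of both
  constants, therefore follow once \<open>D\<close> is strictly decreasing from \<open>n = 1\<close> on.

  The difference \<open>D (n - 1) - D n\<close> is the value at \<open>x = n\<close> of the step function
  \<open>L x a - L (x - 1) a - 1 / x\<close>, which tends to \<open>0\<close> at infinity. Its derivative is a rational
  function of \<open>x\<^sup>2\<close>. The logarithmic weights and nodes in \<open>L\<close> are such that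
  the numerator of this derivative, a priori of degree four in \<open>x\<^sup>2\<close>, collapses to the linear
  polynomial \<open>(4/45 + 15 s)\<^sup>2 - (16/135 - 7 s) x\<^sup>2\<close> with \<open>s = (a - 1 / (45 a)) / 45\<close>
  (lemmas \<open>step_numerator\<close> and \<open>has_derivative_step\<close>). So the sign of the derivative can be read
  off. For \<open>a\<close> between \<open>1/15\<close> and \<open>0.513\<close> it is negative for \<open>x \<ge> 2\<close>; a function decreasing
  to \<open>0\<close> is positive, and hence \<open>D\<close> decreases.

  It remains to locate \<open>a0\<close>. The map \<open>a \<mapsto> L 0 a\<close> is strictly increasing
  (\<open>L_strict_mono_parameter\<close>): up to a positive factor its derivative is the error of the trapezoidal
  rule for \<open>\<integral> dx / x\<close>. So \<open>a0\<close> is the only solution of \<open>L 0 a = - euler_mascheroni\<close>, and twelve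
  digits of it require \<open>euler_mascheroni\<close> to about fifteen digits. The step function supplies these
  as well. The coefficient \<open>16/135 - 7 s\<close> vanishes for an \<open>a\<close> near \<open>0.79\<close>. Slightly below that
  value \<open>D\<close> decreases eventually, and slightly above it \<open>D\<close> increases, with a remainder that in
  both cases is a tiny multiple of \<open>n\<^sup>-\<^sup>6\<close>. So \<open>D 80\<close> at \<open>a = 0.78\<close> and at \<open>a = 0.8\<close> encloses
  \<open>euler_mascheroni\<close> in an interval of length below \<open>10\<^sup>-\<^sup>1\<^sup>5\<close>.
\<close>

section \<open>Monotonicity of the error of the approximation\<close>

text \<open>
  Twice the coefficients of the two logarithms form a probability distribution on the nodes
  \<open>1/3 + a\<close> and \<open>1/3 - 1 / (45 a)\<close>. Its mean \<open>1/3\<close> and variance \<open>1/45\<close> do not depend on \<open>a\<close>;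
  its third central moment is \<open>skew a\<close>. This parameter alone decides the sign of the leading error
  term.
\<close>

definition skew :: "real \<Rightarrow> real" where
  "skew a = (a - 1 / (45 * a)) / 45"

lemma L_eq:
  assumes "a > 1 / 15"
  shows "L x a = 1 / (90 * a^2 + 2) * ln (x^2 + x + (1/3 + a))
           + 45 * a^2 / (90 * a^2 + 2) * ln (x^2 + x + (1/3 - 1 / (45 * a)))"
proof -
  have "(3 * a + 1) / 3 = 1/3 + a" "(15 * a - 1) / (45 * a) = 1/3 - 1 / (45 * a)"
    using assms by (simp_all add: field_simps)
  then show ?thesis by (simp only: L_def)
qed

lemma lower_node_pos: "a > 1 / 15 \<Longrightarrow> 1/3 - 1 / (45 * a) > (0::real)"
  by (simp add: field_simps)

text \<open>
  With \<open>b = 1 / (45 a)\<close> the weights are \<open>b / (2 (a + b))\<close> and \<open>a / (2 (a + b))\<close>. The left-hand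
  side is what remains of the derivative of the step after clearing denominators, with \<open>M\<close> for
  \<open>x\<^sup>2\<close>. Matching the first two moments cancels the powers \<open>M\<^sup>4\<close>, \<open>M\<^sup>3\<close> and \<open>M\<^sup>2\<close>. The
  constant term is \<open>(A B)\<^sup>2\<close>, where \<open>A B = 4/45 + 15 s\<close>.
\<close>

lemma step_numerator:
  fixes a b s M :: real
  assumes "45 * a * b = 1" "s = (a - b) / 45"
  defines "A \<equiv> 1/3 + a" and "B \<equiv> 1/3 - b"
  shows "b * (A - M) * (M * ((M + B)^2 - M)) + a * (B - M) * (M * ((M + A)^2 - M))
           + (a + b) * (((M + A)^2 - M) * ((M + B)^2 - M))
         = (a + b) * ((4/45 + 15 * s)^2 - (16/135 - 7 * s) * M)"
  unfolding assms(2) A_def B_def using assms(1) by algebra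

lemma has_derivative_step:
  fixes a x :: real
  assumes a: "a > 1 / 15" and x: "x \<ge> 1"
  defines "A \<equiv> 1/3 + a" and "B \<equiv> 1/3 - 1 / (45 * a)"
  shows "((\<lambda>x. L x a - L (x - 1) a - 1 / x) has_real_derivative
           ((4/45 + 15 * skew a)^2 - (16/135 - 7 * skew a) * x^2)
             / (x^2 * ((x^2 + A)^2 - x^2) * ((x^2 + B)^2 - x^2))) (at x)"
    and "x^2 * ((x^2 + A)^2 - x^2) * ((x^2 + B)^2 - x^2) > 0"
proof -
  define b where "b = 1 / (45 * a)"
  have A: "A > 0" and B: "B > 0" using a lower_node_pos[OF a] by (auto simp: A_def B_def)
  have b: "b > 0" "45 * a * b = 1" using a by (auto simp: b_def)
  have fac: "(x^2 + C)^2 - x^2 = (x^2 + x + C) * (x^2 - x + C)" for C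
    by (simp add: power2_eq_square algebra_simps)
  have pos: "x^2 - x + C > 0" "x^2 + x + C > 0" "(x^2 + C)^2 - x^2 > 0" if "C > 0" for C
  proof -
    have "x^2 - x \<ge> 0" using x by (simp add: power2_eq_square)
    then show "x^2 - x + C > 0" "x^2 + x + C > 0" using that x by linarith+
    then show "(x^2 + C)^2 - x^2 > 0" unfolding fac by simp
  qed
  show dpos: "x^2 * ((x^2 + A)^2 - x^2) * ((x^2 + B)^2 - x^2) > 0"
    using pos(3)[OF A] pos(3)[OF B] x by simp
  have der: "((\<lambda>x. ln (x^2 + x + C) - ln ((x-1)^2 + (x-1) + C)) has_real_derivative
          2 * (C - x^2) / ((x^2 + C)^2 - x^2)) (at x)" if "C > 0" for C
  proof -
    have e: "(x-1)^2 + (x-1) + C = x^2 - x + C" by (simp add: power2_eq_square algebra_simps)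
    have "((\<lambda>x. ln (x^2 + x + C) - ln ((x-1)^2 + (x-1) + C)) has_real_derivative
          (2 * x + 1) / (x^2 + x + C) - (2 * x - 1) / (x^2 - x + C)) (at x)"
      using pos[OF that] by (auto intro!: derivative_eq_intros simp: e)
    moreover have "(2 * x + 1) / (x^2 + x + C) - (2 * x - 1) / (x^2 - x + C)
        = 2 * (C - x^2) / ((x^2 + C)^2 - x^2)"
      unfolding fac using pos[OF that]
      by (simp add: field_simps) (simp add: power2_eq_square algebra_simps)
    ultimately show ?thesis by simp
  qed
  \<comment> \<open>In terms of \<open>b\<close> the weights are symmetric, which makes the numerator a polynomial identity
    modulo \<open>45 a b = 1\<close>.\<close>
  have w: "1 / (90 * a^2 + 2) = b / (2 * (a + b))" "45 * a^2 / (90 * a^2 + 2) = a / (2 * (a + b))"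
  proof -
    have "90 * a^2 + 2 > 0" by (simp add: add_nonneg_pos)
    moreover have "a + b > 0" using a b(1) by simp
    moreover have "2 * (a + b) = b * (90 * a^2 + 2)" "a * (90 * a^2 + 2) = 45 * a^2 * (2 * (a + b))"
      using b(2) by algebra+
    ultimately show "1 / (90 * a^2 + 2) = b / (2 * (a + b))"
      "45 * a^2 / (90 * a^2 + 2) = a / (2 * (a + b))"
      using b(1) by (simp_all add: divide_eq_eq eq_divide_eq)
  qed
  have Leq: "L y a = b / (2 * (a + b)) * ln (y^2 + y + A) + a / (2 * (a + b)) * ln (y^2 + y + B)" for y
    unfolding L_eq[OF a] A_def B_def w ..
  have "((\<lambda>x. b / (2 * (a + b)) * (ln (x^2 + x + A) - ln ((x-1)^2 + (x-1) + A))
            + a / (2 * (a + b)) * (ln (x^2 + x + B) - ln ((x-1)^2 + (x-1) + B)) + (- 1 / x))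
     has_real_derivative b / (2 * (a + b)) * (2 * (A - x^2) / ((x^2 + A)^2 - x^2))
        + a / (2 * (a + b)) * (2 * (B - x^2) / ((x^2 + B)^2 - x^2)) + 1 / x^2) (at x)"
  proof (intro DERIV_add DERIV_cmult der A B)
    show "((\<lambda>x. - 1 / x) has_real_derivative 1 / x^2) (at x)"
      using x by (auto intro!: derivative_eq_intros simp: power2_eq_square)
  qed
  also have "(\<lambda>x. b / (2 * (a + b)) * (ln (x^2 + x + A) - ln ((x-1)^2 + (x-1) + A))
            + a / (2 * (a + b)) * (ln (x^2 + x + B) - ln ((x-1)^2 + (x-1) + B)) + (- 1 / x))
     = (\<lambda>x. L x a - L (x - 1) a - 1 / x)"
    unfolding Leq by (simp add: algebra_simps)
  also have "b / (2 * (a + b)) * (2 * (A - x^2) / ((x^2 + A)^2 - x^2))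
        + a / (2 * (a + b)) * (2 * (B - x^2) / ((x^2 + B)^2 - x^2)) + 1 / x^2
     = ((4/45 + 15 * skew a)^2 - (16/135 - 7 * skew a) * x^2)
             / (x^2 * ((x^2 + A)^2 - x^2) * ((x^2 + B)^2 - x^2))"
  proof -
    define P where "P = (x^2 + A)^2 - x^2"
    define Q where "Q = (x^2 + B)^2 - x^2"
    define M where "M = x^2"
    have nz: "P \<noteq> 0" "Q \<noteq> 0" "M \<noteq> 0" "a + b \<noteq> 0"
      using pos(3)[OF A] pos(3)[OF B] x a b(1) by (auto simp: P_def Q_def M_def)
    have skew: "skew a = (a - b) / 45" by (simp add: skew_def b_def)
    have num: "b * (A - M) * (M * Q) + a * (B - M) * (M * P) + (a + b) * (P * Q)
         = (a + b) * ((4/45 + 15 * skew a)^2 - (16/135 - 7 * skew a) * M)"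
      using step_numerator[OF b(2) skew, of M]
      by (simp only: P_def Q_def M_def A_def B_def b_def)
    have "b / (2 * (a + b)) * (2 * (A - M) / P) + a / (2 * (a + b)) * (2 * (B - M) / Q) + 1 / M
        = (b * (A - M) * (M * Q) + a * (B - M) * (M * P) + (a + b) * (P * Q)) / ((a + b) * (M * P * Q))"
      using nz by (simp add: divide_simps) (simp add: algebra_simps)
    also have "\<dots> = ((4/45 + 15 * skew a)^2 - (16/135 - 7 * skew a) * M) / (M * P * Q)"
      unfolding num using nz by simp
    finally show ?thesis by (simp only: M_def P_def Q_def)
  qed
  finally show "((\<lambda>x. L x a - L (x - 1) a - 1 / x) has_real_derivative
           ((4/45 + 15 * skew a)^2 - (16/135 - 7 * skew a) * x^2)
             / (x^2 * ((x^2 + A)^2 - x^2) * ((x^2 + B)^2 - x^2))) (at x)" .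
qed

lemma L_asymp_ln:
  assumes "a > 1 / 15"
  shows "((\<lambda>x. L x a - ln x) \<longlongrightarrow> 0) at_top"
proof -
  have lim: "((\<lambda>x::real. ln (x^2 + x + C) - 2 * ln x) \<longlongrightarrow> 0) at_top" for C
    by real_asymp
  have "90 * a^2 + 2 > 0" by (simp add: add_nonneg_pos)
  then have w: "45 * a^2 / (90 * a^2 + 2) = 1/2 - 1 / (90 * a^2 + 2)"
    by (simp add: field_simps)
  have "((\<lambda>x. 1 / (90 * a^2 + 2) * (ln (x^2 + x + (1/3 + a)) - 2 * ln x)
      + 45 * a^2 / (90 * a^2 + 2) * (ln (x^2 + x + (1/3 - 1 / (45 * a))) - 2 * ln x))
      \<longlongrightarrow> 1 / (90 * a^2 + 2) * 0 + 45 * a^2 / (90 * a^2 + 2) * 0) at_top"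
    by (intro tendsto_intros lim)
  also have "(\<lambda>x. 1 / (90 * a^2 + 2) * (ln (x^2 + x + (1/3 + a)) - 2 * ln x)
      + 45 * a^2 / (90 * a^2 + 2) * (ln (x^2 + x + (1/3 - 1 / (45 * a))) - 2 * ln x))
      = (\<lambda>x. L x a - ln x)"
    unfolding L_eq[OF assms] w by (simp add: algebra_simps)
  finally show ?thesis by simp
qed

lemma step_tendsto_0:
  assumes "a > 1 / 15"
  shows "((\<lambda>x. L x a - L (x - 1) a - 1 / x) \<longlongrightarrow> 0) at_top"
proof -
  have sh: "filterlim (\<lambda>x::real. x - 1) at_top at_top" by real_asymp
  have "((\<lambda>x::real. (L x a - ln x) - (L (x - 1) a - ln (x - 1)) + (ln x - ln (x - 1) - 1 / x))
        \<longlongrightarrow> 0 - 0 + 0) at_top"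
    by (intro tendsto_add tendsto_diff L_asymp_ln[OF assms] filterlim_compose[OF L_asymp_ln[OF assms] sh])
       real_asymp
  then show ?thesis by (simp add: algebra_simps)
qed

lemma harm_minus_L_tendsto:
  assumes "a > 1 / 15"
  shows "(\<lambda>n. harm n - L (real n) a) \<longlonglongrightarrow> euler_mascheroni"
proof -
  have "(\<lambda>n. (harm n - ln (real n)) - (L (real n) a - ln (real n))) \<longlonglongrightarrow> euler_mascheroni - 0"
    by (intro tendsto_diff euler_mascheroni_LIMSEQ
        filterlim_compose[OF L_asymp_ln[OF assms] filterlim_real_sequentially])
  then show ?thesis by simp
qed

lemma harm_Suc_minus_L:
  "harm (Suc n) - L (real (Suc n)) a
     = harm n - L (real n) a - (L (real (Suc n)) a - L (real (Suc n) - 1) a - 1 / real (Suc n))"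
  by (simp add: harm_Suc inverse_eq_divide)

text \<open>
  The hypothesis says that the numerator of the derivative is negative at \<open>x = n + 1\<close>, and then it is
  negative for all larger \<open>x\<close> because it decreases. So the step decreases to its limit \<open>0\<close> from
  \<open>n + 1\<close> on and is positive there.
\<close>

lemma harm_minus_L_decreasing:
  assumes a: "a > 1 / 15" and k: "16/135 - 7 * skew a > 0"
    and n: "(4/45 + 15 * skew a)^2 < (16/135 - 7 * skew a) * (real (Suc n))^2"
  shows "harm (Suc n) - L (real (Suc n)) a < harm n - L (real n) a"
proof -
  let ?f = "\<lambda>x. L x a - L (x - 1) a - 1 / x"
  have "0 < ?f (real (Suc n))"
  proof (rule DERIV_neg_imp_decreasing_at_top[OF _ step_tendsto_0[OF a]])
    fix x :: real assume x: "x \<ge> real (Suc n)"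
    then have "x \<ge> 1" by simp
    note der = has_derivative_step[OF a this]
    have "(real (Suc n))^2 \<le> x^2" using x by (intro power_mono) auto
    then have "(16/135 - 7 * skew a) * (real (Suc n))^2 \<le> (16/135 - 7 * skew a) * x^2"
      using k by (intro mult_left_mono) auto
    with n have "(4/45 + 15 * skew a)^2 - (16/135 - 7 * skew a) * x^2 < 0" by linarith
    with der show "\<exists>y. DERIV ?f x :> y \<and> y < 0" by (meson divide_neg_pos)
  qed
  then show ?thesis unfolding harm_Suc_minus_L by simp
qed

text \<open>
  When the coefficient of \<open>x\<^sup>2\<close> has the other sign, the numerator is positive everywhere and the step
  increases to \<open>0\<close>. Such parameters yield lower bounds for \<open>euler_mascheroni\<close>.
\<close>

lemma harm_minus_L_increasing:
  assumes a: "a > 1 / 15" and k: "16/135 - 7 * skew a \<le> 0" and c: "4/45 + 15 * skew a \<noteq> 0"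
  shows "harm n - L (real n) a < harm (Suc n) - L (real (Suc n)) a"
proof -
  let ?f = "\<lambda>x. L x a - L (x - 1) a - 1 / x"
  have lim: "((\<lambda>x. - ?f x) \<longlongrightarrow> 0) at_top"
    using tendsto_minus[OF step_tendsto_0[OF a]] by simp
  have "0 < - ?f (real (Suc n))"
  proof (rule DERIV_neg_imp_decreasing_at_top[OF _ lim])
    fix x :: real assume x: "x \<ge> real (Suc n)"
    then have "x \<ge> 1" by simp
    note der = has_derivative_step[OF a this]
    have "(16/135 - 7 * skew a) * x^2 \<le> 0" using k by (simp add: mult_nonpos_nonneg)
    moreover have "(4/45 + 15 * skew a)^2 > 0" using c by simp
    ultimately have "(4/45 + 15 * skew a)^2 - (16/135 - 7 * skew a) * x^2 > 0" by linarith
    with der(2) DERIV_minus[OF der(1)] show "\<exists>y. DERIV (\<lambda>x. - ?f x) x :> y \<and> y < 0"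
      by (meson divide_pos_pos neg_less_0_iff_less)
  qed
  then show ?thesis unfolding harm_Suc_minus_L by simp
qed

lemma limit_less_if_decreasing_from:
  fixes X :: "nat \<Rightarrow> real"
  assumes lim: "X \<longlonglongrightarrow> l" and dec: "\<And>n. n \<ge> n0 \<Longrightarrow> X (Suc n) < X n"
  shows "l < X n0"
proof -
  have "X n \<le> X (Suc n0)" if "n \<ge> Suc n0" for n
    using that
  proof (induction n rule: dec_induct)
    case (step n)
    then show ?case using dec[of n] by simp
  qed simp
  then have "l \<le> X (Suc n0)" by (intro LIMSEQ_le_const2[OF lim]) auto
  with dec[of n0] show ?thesis by simp
qed

section \<open>Dependence on the parameter\<close>

lemma ln_less_half_diff_inverse:
  fixes r :: real
  assumes "r > 1"
  shows "ln r < (r - 1 / r) / 2"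
proof -
  have "(1 - 1 / 1) / 2 - ln 1 < (r - 1 / r) / 2 - ln (r::real)"
  proof (rule DERIV_pos_imp_increasing_open[OF assms])
    fix x :: real assume "1 < x" "x < r"
    then have "((\<lambda>x. (x - 1 / x) / 2 - ln x) has_real_derivative (1 - 1 / x)^2 / 2) (at x)"
      by (auto intro!: derivative_eq_intros simp: field_simps power2_eq_square)
    moreover have "(1 - 1 / x)^2 / 2 > 0" using \<open>1 < x\<close> by simp
    ultimately show "\<exists>y. ((\<lambda>x. (x - 1 / x) / 2 - ln x) has_real_derivative y) (at x) \<and> y > 0"
      by blast
  next
    show "continuous_on {1..r} (\<lambda>x. (x - 1 / x) / 2 - ln x)"
      by (intro continuous_intros) auto
  qed
  then show ?thesis by simp
qed

text \<open>
  The common factor appears because \<open>A - B = a + 1 / (45 a)\<close> is \<open>(90 a\<^sup>2 + 2) / (90 a)\<close>: the moving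
  weights contribute the difference quotient of the logarithm, and the moving nodes contribute its
  derivatives at the endpoints.
\<close>

lemma has_derivative_L_parameter:
  fixes a x :: real
  assumes a: "a > 1 / 15" and x: "x \<ge> 0"
  defines "A \<equiv> x^2 + x + (1/3 + a)" and "B \<equiv> x^2 + x + (1/3 - 1 / (45 * a))"
  shows "((\<lambda>a. L x a) has_real_derivative
           (1 / A + 1 / B - 2 * ln (A / B) / (A - B)) / (90 * a^2 + 2)) (at a)"
proof -
  have pos: "A > 0" "B > 0"
    using a x lower_node_pos[OF a] by (auto simp: A_def B_def add_nonneg_pos)
  have w: "90 * a^2 + 2 > 0" by (simp add: add_nonneg_pos)
  have "A - B = a + 1 / (45 * a)" by (simp add: A_def B_def)
  then have AB: "A - B = (90 * a^2 + 2) / (90 * a)" using a by (simp add: field_simps power2_eq_square)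
  have "((\<lambda>a. 1 / (90 * a^2 + 2) * ln (x^2 + x + (1/3 + a))
           + 45 * a^2 / (90 * a^2 + 2) * ln (x^2 + x + (1/3 - 1 / (45 * a)))) has_real_derivative
           - (180 * a) / (90 * a^2 + 2)^2 * ln A + 1 / (90 * a^2 + 2) * (1 / A)
           + ((180 * a) / (90 * a^2 + 2)^2 * ln B
              + 45 * a^2 / (90 * a^2 + 2) * (1 / (45 * a^2) / B))) (at a)"
  proof (intro DERIV_add DERIV_cong[OF DERIV_mult])
    show "((\<lambda>a. 1 / (90 * a^2 + 2)) has_real_derivative - (180 * a) / (90 * a^2 + 2)^2) (at a)"
      using w by (auto intro!: derivative_eq_intros simp: power2_eq_square)
    show "((\<lambda>a. 45 * a^2 / (90 * a^2 + 2)) has_real_derivative (180 * a) / (90 * a^2 + 2)^2) (at a)"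
      using w by (auto intro!: derivative_eq_intros simp: power2_eq_square field_simps)
    show "((\<lambda>a. ln (x^2 + x + (1/3 + a))) has_real_derivative 1 / A) (at a)"
      using pos by (auto intro!: derivative_eq_intros simp: A_def)
    show "((\<lambda>a. ln (x^2 + x + (1/3 - 1 / (45 * a)))) has_real_derivative 1 / (45 * a^2) / B) (at a)"
      using pos a by (auto intro!: derivative_eq_intros simp: B_def power2_eq_square field_simps)
  qed (auto simp: A_def B_def)
  also have "- (180 * a) / (90 * a^2 + 2)^2 * ln A + 1 / (90 * a^2 + 2) * (1 / A)
           + ((180 * a) / (90 * a^2 + 2)^2 * ln B
              + 45 * a^2 / (90 * a^2 + 2) * (1 / (45 * a^2) / B))
      = (1 / A + 1 / B - 2 * ln (A / B) / (A - B)) / (90 * a^2 + 2)"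
  proof -
    have c: "45 * a^2 / (90 * a^2 + 2) * (1 / (45 * a^2) / B) = 1 / (90 * a^2 + 2) * (1 / B)"
      using a by simp
    have d: "2 * ln (A / B) / (A - B) = 180 * a / (90 * a^2 + 2) * (ln A - ln B)"
      using pos a by (simp add: AB ln_div)
    show ?thesis unfolding c d using w by (simp add: divide_simps) (simp add: algebra_simps power2_eq_square)
  qed
  finally have der: "((\<lambda>a. 1 / (90 * a^2 + 2) * ln (x^2 + x + (1/3 + a))
           + 45 * a^2 / (90 * a^2 + 2) * ln (x^2 + x + (1/3 - 1 / (45 * a)))) has_real_derivative
       (1 / A + 1 / B - 2 * ln (A / B) / (A - B)) / (90 * a^2 + 2)) (at a)" .
  show ?thesis
    by (rule has_field_derivative_transform_within_open[OF der, of "{1/15<..}"])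
       (use a in \<open>auto simp: L_eq\<close>)
qed

text \<open>
  The derivative compares \<open>(1 / A + 1 / B) / 2\<close> with the mean value of \<open>1 / x\<close> over \<open>{B..A}\<close>; the
  former is larger because \<open>1 / x\<close> is convex. Dividing by \<open>B\<close> turns this into the inequality for
  \<open>ln r\<close> with \<open>r = A / B\<close>.
\<close>

lemma L_strict_mono_parameter:
  fixes a b x :: real
  assumes a: "a > 1 / 15" and ab: "a < b" and x: "x \<ge> 0"
  shows "L x a < L x b"
proof (rule DERIV_pos_imp_increasing[OF ab])
  fix t assume "a \<le> t" "t \<le> b"
  then have t: "t > 1 / 15" using a by simp
  define A where "A = x^2 + x + (1/3 + t)"
  define B where "B = x^2 + x + (1/3 - 1 / (45 * t))"
  have B: "B > 0" using x lower_node_pos[OF t] by (auto simp: B_def add_nonneg_pos)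
  have "1 / (45 * t) > 0" using t by simp
  then have AB: "A > B" using t unfolding A_def B_def by linarith
  then have "ln (A / B) < (A / B - 1 / (A / B)) / 2"
    using B by (intro ln_less_half_diff_inverse) simp
  also have "\<dots> = (1 / A + 1 / B) * (A - B) / 2"
    using AB B by (simp add: field_simps power2_eq_square)
  finally have "2 * ln (A / B) / (A - B) < 1 / A + 1 / B"
    using AB by (simp add: pos_divide_less_eq)
  moreover have "90 * t^2 + 2 > 0" by (simp add: add_nonneg_pos)
  ultimately have "(1 / A + 1 / B - 2 * ln (A / B) / (A - B)) / (90 * t^2 + 2) > 0" by simp
  with has_derivative_L_parameter[OF t x] show "\<exists>y. DERIV (\<lambda>a. L x a) t :> y \<and> y > 0"
    unfolding A_def B_def by blast
qed

section \<open>Numerical enclosures of logarithms\<close>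

text \<open>
  Partial sums of \<open>ln x = 2 artanh y\<close>, with a geometric bound for the tail. The powers are written out
  so that rational arithmetic evaluates them at numerals. Three terms give more than sixteen digits when
  \<open>x\<close> is within one percent of \<open>1\<close>; six terms serve the ratios further away.
\<close>

lemma ln_between_3:
  fixes x :: real
  assumes "x > 1"
  defines "y \<equiv> (x - 1) / (x + 1)"
  shows "2 * (y + y^3 / 3 + y^5 / 5) \<le> ln x"
    and "ln x \<le> 2 * (y + y^3 / 3 + y^5 / 5 + y^7 / (1 - y^2) / 7)"
  using ln_approx_bounds[of x 3] assms(1)
  by (simp_all add: eval_nat_numeral y_def del: power_Suc)

lemma ln_between_6:
  fixes x :: real
  assumes "x > 1"
  defines "y \<equiv> (x - 1) / (x + 1)"
  shows "2 * (y + y^3 / 3 + y^5 / 5 + y^7 / 7 + y^9 / 9 + y^11 / 11) \<le> ln x"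
    and "ln x \<le> 2 * (y + y^3 / 3 + y^5 / 5 + y^7 / 7 + y^9 / 9 + y^11 / 11
                        + y^13 / (1 - y^2) / 13)"
  using ln_approx_bounds[of x 6] assms(1)
  by (simp_all add: eval_nat_numeral y_def del: power_Suc)

text \<open>
  Reduces the logarithm of a positive rational number to those of \<open>2\<close>, \<open>3\<close>, \<open>5\<close> and of a number close
  to \<open>1\<close>, where the series above converges fast.
\<close>

lemma ln_smooth_mult:
  fixes x :: real and i j k :: int
  assumes "x > 0"
  shows "ln (2 powi i * 3 powi j * 5 powi k * x)
           = of_int i * ln 2 + of_int j * ln 3 + of_int k * ln 5 + ln x"
proof -
  have "ln (b powi n) = of_int n * ln b" if "b > 0" for b :: real and n :: int
    using that by (simp add: powr_real_of_int' [symmetric] ln_powr)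
  then show ?thesis using assms by (simp add: ln_mult)
qed

text \<open>
  The ratios \<open>16/15\<close>, \<open>25/24\<close> and \<open>81/80\<close> of consecutive integers have no prime factors other than
  \<open>2\<close>, \<open>3\<close> and \<open>5\<close>, and their exponent matrix has determinant \<open>\<plusminus>1\<close>. So \<open>ln 2\<close>,
  \<open>ln 3\<close> and \<open>ln 5\<close> are integer combinations of three rapidly convergent series.
\<close>

lemma ln_2_3_5_bounds:
  shows
    "0.693147180559945307 \<le> ln (2::real)" "ln (2::real) \<le> 0.693147180559945312"
    "1.098612288668109689 \<le> ln (3::real)" "ln (3::real) \<le> 1.098612288668109694"
    "1.609437912434100372 \<le> ln (5::real)" "ln (5::real) \<le> 1.609437912434100377"
proof -
  have a: "0.06453852113757117166 \<le> ln (16/15::real)"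
    "ln (16/15::real) \<le> 0.06453852113757117168"
    using ln_between_6[of "16/15"] by (simp_all add: power_divide)
  have b: "0.04082199452025512955 \<le> ln (25/24::real)"
    "ln (25/24::real) \<le> 0.04082199452025512956"
    using ln_between_6[of "25/24"] by (simp_all add: power_divide)
  have c: "0.01242251999855715331 \<le> ln (81/80::real)"
    "ln (81/80::real) \<le> 0.01242251999855715332"
    using ln_between_6[of "81/80"] by (simp_all add: power_divide)
  have "ln (16/15) = 4 * ln 2 - ln 3 - ln (5::real)"
    using ln_smooth_mult[of 1 4 "-1" "-1"] by simp
  moreover have "ln (25/24) = 2 * ln 5 - 3 * ln 2 - ln (3::real)"
    using ln_smooth_mult[of 1 "-3" "-1" 2] by simp
  moreover have "ln (81/80) = 4 * ln 3 - 4 * ln 2 - ln (5::real)"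
    using ln_smooth_mult[of 1 "-4" 4 "-1"] by simp
  ultimately show
    "0.693147180559945307 \<le> ln (2::real)" "ln (2::real) \<le> 0.693147180559945312"
    "1.098612288668109689 \<le> ln (3::real)" "ln (3::real) \<le> 1.098612288668109694"
    "1.609437912434100372 \<le> ln (5::real)" "ln (5::real) \<le> 1.609437912434100377"
    using a b c by simp_all
qed

section \<open>The Euler--Mascheroni constant to fifteen digits\<close>

text \<open>
  The index \<open>80\<close> is chosen because \<open>80 \<sqdot> 81 = 2\<^sup>4 3\<^sup>4 5\<close>: the arguments of the logarithms in
  \<open>L 80 a\<close> exceed this number by less than \<open>2\<close>.
\<close>

lemma harm_80: "harm 80 = (4880292608058024066886120358155997/982844219842241906412811281988800 :: real)"
  by (simp add: harm_expand)

lemma harm_80_minus_L_upper: "harm 80 - L 80 0.78 < 0.577215664901534"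
proof -
  have "0.00017179594182056 \<le> ln (972167/972000::real)"
    using ln_between_3[of "972167/972000"] by (simp add: power_divide)
  moreover have "ln (972167/150) = 4 * ln 2 + 4 * ln 3 + ln 5 + ln (972167/972000::real)"
    using ln_smooth_mult[of "972167/972000" 4 4 1] by simp
  ultimately have ln1: "8.7766475852881409 \<le> ln (972167/150::real)"
    using ln_2_3_5_bounds by simp
  have "0.00004704261336213 \<le> ln (2274587/2274480::real)"
    using ln_between_3[of "2274587/2274480"] by (simp add: power_divide)
  moreover have "ln (2274587/351) = 4 * ln 2 + 4 * ln 3 + ln 5 + ln (2274587/2274480::real)"
    using ln_smooth_mult[of "2274587/2274480" 4 4 1] by simp
  ultimately have ln2: "8.7765228319596824 \<le> ln (2274587/351::real)"
    using ln_2_3_5_bounds by simp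
  have "L 80 0.78 = 250/14189 * ln (972167/150)
      + 13689/28378 * ln (2274587/351)"
    by (simp add: L_def power2_eq_square)
  then show ?thesis
    using ln1 ln2 harm_80 by simp
qed

lemma harm_80_minus_L_lower: "0.577215664901532 < harm 80 - L 80 0.8"
proof -
  have "ln (97217/97200::real) \<le> 0.00017488182662347"
    using ln_between_3[of "97217/97200"] by (simp add: power_divide)
  moreover have "ln (97217/15) = 4 * ln 2 + 4 * ln 3 + ln 5 + ln (97217/97200::real)"
    using ln_smooth_mult[of "97217/97200" 4 4 1] by simp
  ultimately have ln1: "ln (97217/15::real) \<le> 8.7766506711729439"
    using ln_2_3_5_bounds by simp
  have "ln (233291/233280::real) \<le> 0.00004715252341890"
    using ln_between_3[of "233291/233280"] by (simp add: power_divide)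
  moreover have "ln (233291/36) = 4 * ln 2 + 4 * ln 3 + ln 5 + ln (233291/233280::real)"
    using ln_smooth_mult[of "233291/233280" 4 4 1] by simp
  ultimately have ln2: "ln (233291/36::real) \<le> 8.7765229418697394"
    using ln_2_3_5_bounds by simp
  have "L 80 0.8 = 5/298 * ln (97217/15)
      + 72/149 * ln (233291/36)"
    by (simp add: L_def power2_eq_square)
  then show ?thesis
    using ln1 ln2 harm_80 by simp
qed

text \<open>
  At \<open>a = 0.78\<close> the coefficient \<open>16/135 - 7 skew a\<close> is small but positive, and
  the criterion for \<open>harm n - L n a\<close> to decrease is met only from \<open>n = 8\<close> on. The value at \<open>80\<close>
  therefore still exceeds the limit.
\<close>

lemma euler_mascheroni_lt: "euler_mascheroni < (0.577215664901534 :: real)"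
proof -
  have "euler_mascheroni < harm 80 - L (real 80) 0.78"
  proof (rule limit_less_if_decreasing_from[OF harm_minus_L_tendsto])
    fix n :: nat assume "n \<ge> 80"
    then have "(real (Suc n))^2 \<ge> 81^2" by (intro power_mono) auto
    then show "harm (Suc n) - L (real (Suc n)) 0.78 < harm n - L (real n) 0.78"
      by (intro harm_minus_L_decreasing) (simp_all add: skew_def power2_eq_square)
  qed simp
  with harm_80_minus_L_upper show ?thesis by simp
qed

text \<open>
  At \<open>a = 0.8\<close> the coefficient is negative. Negating the increasing sequence turns the same limit
  argument into a lower bound.
\<close>

lemma euler_mascheroni_gt: "(0.577215664901532 :: real) < euler_mascheroni"
proof -
  have "- euler_mascheroni < - (harm 80 - L (real 80) 0.8)"
  proof (rule limit_less_if_decreasing_from[OF tendsto_minus[OF harm_minus_L_tendsto]])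
    fix n :: nat
    show "- (harm (Suc n) - L (real (Suc n)) 0.8) < - (harm n - L (real n) 0.8)"
      using harm_minus_L_increasing[of "0.8" n] by (simp add: skew_def)
  qed simp
  with harm_80_minus_L_lower show ?thesis by simp
qed

section \<open>Location of the root\<close>

text \<open>
  At these parameters \<open>1/3 + a\<close> is close to \<open>27/32\<close> and \<open>1/3 - 1 / (45 a)\<close> is close to \<open>36/125\<close>,
  which have no prime factors other than \<open>2\<close>, \<open>3\<close> and \<open>5\<close>.
\<close>

lemma L_0_lower: "L 0 0.512967071402 < - 0.577215664901534"
proof -
  have "ln (1269450607103/1265625000000::real) \<le> 0.00301814273017686"
    using ln_between_3[of "1269450607103/1265625000000"] by (simp add: power_divide)
  moreover have "ln (1269450607103/1500000000000) = - 5 * ln 2 + 3 * ln 3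
      + ln (1269450607103/1265625000000::real)"
    using ln_smooth_mult[of "1269450607103/1265625000000" "-5" 3 0] by simp
  ultimately have ln1: "ln (1269450607103/1500000000000::real) \<le> - 0.1668808940652205"
    using ln_2_3_5_bounds by simp
  have "ln (83681325887875/83100665567124::real) \<le> 0.00696313387080170"
    using ln_between_3[of "83681325887875/83100665567124"] by (simp add: power_divide)
  moreover have "ln (669450607103/2308351821309) = 2 * ln 2 + 2 * ln 3 - 3 * ln 5
      + ln (83681325887875/83100665567124::real)"
    using ln_smooth_mult[of "83681325887875/83100665567124" 2 2 "-3"] by simp
  ultimately have ln2: "ln (669450607103/2308351821309::real) \<le> - 1.2378316649753893"
    using ln_2_3_5_bounds by simp
  have "L 0 0.512967071402 = 25000000000000000000000/642054236771175274052609 * ln (1269450607103/1500000000000)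
      + 592054236771175274052609/1284108473542350548105218 * ln (669450607103/2308351821309)"
    by (simp add: L_def power2_eq_square)
  then show ?thesis
    using ln1 ln2 by simp
qed

lemma L_0_upper: "- 0.577215664901532 < L 0 0.512967071403"
proof -
  have "0.00301814273135847 \<le> ln (2538901214209/2531250000000::real)"
    using ln_between_3[of "2538901214209/2531250000000"] by (simp add: power_divide)
  moreover have "ln (2538901214209/3000000000000) = - 5 * ln 2 + 3 * ln 3
      + ln (2538901214209/2531250000000::real)"
    using ln_smooth_mult[of "2538901214209/2531250000000" "-5" 3 0] by simp
  ultimately have ln1: "- 0.1668808940640391 \<le> ln (2538901214209/3000000000000::real)"
    using ln_2_3_5_bounds by simp
  have "0.00696313387109289 \<le> ln (167362651776125/166201331134572::real)"
    using ln_between_3[of "167362651776125/166201331134572"] by (simp add: power_divide)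
  moreover have "ln (1338901214209/4616703642627) = 2 * ln 2 + 2 * ln 3 - 3 * ln 5
      + ln (167362651776125/166201331134572::real)"
    using ln_smooth_mult[of "167362651776125/166201331134572" 2 2 "-3"] by simp
  ultimately have ln2: "- 1.2378316649750983 \<le> ln (1338901214209/4616703642627::real)"
    using ln_2_3_5_bounds by simp
  have "L 0 0.512967071403 = 100000000000000000000000/2568216947093934503495681 * ln (2538901214209/3000000000000)
      + 2368216947093934503495681/5136433894187869006991362 * ln (1338901214209/4616703642627)"
    by (simp add: L_def power2_eq_square)
  then show ?thesis
    using ln1 ln2 by simp
qed

lemma a0_bounds: "0.512967071402 < a0" "a0 < 0.512967071403"
proof -
  let ?lo = "0.512967071402 :: real" and ?hi = "0.512967071403 :: real"
  have lo: "L 0 ?lo < - euler_mascheroni" using L_0_lower euler_mascheroni_lt by linarith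
  have hi: "- euler_mascheroni < L 0 ?hi" using L_0_upper euler_mascheroni_gt by linarith
  have "\<exists>a. ?lo \<le> a \<and> a \<le> ?hi \<and> L 0 a = - euler_mascheroni"
  proof (rule IVT)
    show "\<forall>a. ?lo \<le> a \<and> a \<le> ?hi \<longrightarrow> isCont (L 0) a"
    proof (intro allI impI)
      fix a assume "?lo \<le> a \<and> a \<le> ?hi"
      then have "a > 1 / 15" by simp
      from DERIV_isCont[OF has_derivative_L_parameter[OF this, of 0]]
      show "isCont (L 0) a" by simp
    qed
  qed (use lo hi in simp_all)
  then obtain a where a: "?lo \<le> a" "a \<le> ?hi" "L 0 a = - euler_mascheroni" by blast
  have a15: "a > 1 / 15" using a(1) by simp
  have "a0 = a" unfolding a0_def
  proof (rule the_equality)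
    show "a > 1 / 15 \<and> Digamma 1 - L 0 a = 0" using a15 a(3) by simp
  next
    fix b :: real assume b: "b > 1 / 15 \<and> Digamma 1 - L 0 b = 0"
    then have "L 0 b = L 0 a" using a(3) by simp
    then show "b = a"
      using L_strict_mono_parameter[of a b 0] L_strict_mono_parameter[of b a 0] a15 b
      by (metis linorder_less_linear order_less_irrefl order_refl)
  qed
  moreover have "a \<noteq> ?lo" "a \<noteq> ?hi" using a(3) lo hi by (metis less_irrefl)+
  ultimately show "?lo < a0" "a0 < ?hi" using a(1,2) by auto
qed

section \<open>The bounds for harmonic numbers\<close>

text \<open>
  On this range of \<open>a\<close> the parameter \<open>skew a\<close> lies between \<open>- 4/675\<close> and \<open>0.01045\<close>. The numerator
  of the derivative of the step is then already negative at \<open>x = 2\<close>, with ample room.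
\<close>

lemma harm_minus_L_decreasing_small_parameter:
  assumes a: "a > 1 / 15" "a < 0.513" and n: "n \<ge> 1"
  shows "harm (Suc n) - L (real (Suc n)) a < harm n - L (real n) a"
proof -
  have a': "a < 513 / 1000" using a(2) by simp
  have "1 / (45 * a) < 1 / 3" "1 / (45 * a) > 43 / 1000" using a by (simp_all add: field_simps)
  moreover have "45 * skew a = a - 1 / (45 * a)" by (simp add: skew_def)
  ultimately have s: "4/45 + 15 * skew a > 0" "skew a < 1045 / 100000"
    using a(1) a' by linarith+
  have k: "16/135 - 7 * skew a > 0.045" using s by simp
  have "(4/45 + 15 * skew a)^2 \<le> 0.25^2" using s by (intro power_mono) simp_all
  also have "\<dots> < 0.045 * (2::real)^2" by (simp add: power2_eq_square)
  also have "\<dots> \<le> (16/135 - 7 * skew a) * (real (Suc n))^2"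
    using k n by (intro mult_mono power_mono) simp_all
  finally show ?thesis using k by (intro harm_minus_L_decreasing a) simp_all
qed

lemma harm_bounds:
  fixes a :: real and n :: nat
  assumes a: "a > 1 / 15" "a < 0.513" and n: "n \<ge> 1"
  shows "L (real n) a + euler_mascheroni < harm n"
    and "harm n \<le> L (real n) a + c1 a"
    and "n \<noteq> 1 \<Longrightarrow> harm n < L (real n) a + c1 a"
proof -
  let ?D = "\<lambda>n. harm n - L (real n) a"
  note dec = harm_minus_L_decreasing_small_parameter[OF a]
  have "euler_mascheroni < ?D n"
    by (rule limit_less_if_decreasing_from[OF harm_minus_L_tendsto[OF a(1)]])
       (use n dec in simp)
  then show "L (real n) a + euler_mascheroni < harm n" by simp
  \<comment> \<open>The upper bound is the initial value of the decreasing sequence, so it is attained exactly at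
    \<open>n = 1\<close>.\<close>
  have c1: "c1 a = ?D 1" by (simp add: c1_def harm_def)
  have "?D n < ?D 1" if "n > 1"
    using Suc_leI[OF that]
  proof (induction n rule: dec_induct)
    case base
    then show ?case using dec[of 1] by simp
  next
    case (step m)
    then show ?case using dec[of m] by simp
  qed
  with n c1 show "harm n \<le> L (real n) a + c1 a" "n \<noteq> 1 \<Longrightarrow> harm n < L (real n) a + c1 a"
    by (cases "n = 1"; simp)+
qed

lemma c1_half: "c1 (1 / 2) = 1 - 2 / 49 * ln (17 / 6) - 45 / 98 * ln (103 / 45)"
  by (simp add: c1_def L_def power2_eq_square)

lemma c1_half_approx: "\<bar>c1 (1 / 2) - 0.57726\<bar> < 0.000005"
proof -
  have "1.041453874 \<le> ln (17/6::real) \<and> ln (17/6::real) \<le> 1.041453876"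
    using ln_between_6[of "17/16"] ln_smooth_mult[of "17/16" 3 "-1" 0] ln_2_3_5_bounds
    by (simp add: power_divide)
  moreover have "0.828066498 \<le> ln (103/45::real) \<and> ln (103/45::real) \<le> 0.828066499"
    using ln_between_6[of "103/100"] ln_smooth_mult[of "103/100" 2 "-2" 1] ln_2_3_5_bounds
    by (simp add: power_divide)
  ultimately show ?thesis unfolding c1_half by (simp add: abs_less_iff)
qed

theorem corollary7:
  shows "0.512967071402 \<le> a0 \<and> a0 < 0.512967071403
    \<and> (\<forall>a::real. 1 / 15 < a \<and> a < a0 \<longrightarrow>
         (\<forall>n::nat. n \<ge> 1 \<longrightarrow>
            L (real n) a + euler_mascheroni < harm n
          \<and> harm n \<le> L (real n) a + c1 a
          \<and> (n \<noteq> 1 \<longrightarrow> harm n < L (real n) a + c1 a))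
       \<and> (\<forall>c::real. (\<forall>n::nat. n \<ge> 1 \<longrightarrow> L (real n) a + c < harm n) \<longrightarrow> c \<le> euler_mascheroni)
       \<and> (\<forall>c::real. (\<forall>n::nat. n \<ge> 1 \<longrightarrow> harm n \<le> L (real n) a + c) \<longrightarrow> c1 a \<le> c))
    \<and> (\<forall>n::nat. n \<ge> 1 \<longrightarrow>
         2 / 49 * ln ((real n)^2 + real n + 5 / 6)
           + 45 / 98 * ln ((real n)^2 + real n + 13 / 45) + euler_mascheroni < harm n
       \<and> harm n \<le> 2 / 49 * ln ((real n)^2 + real n + 5 / 6)
           + 45 / 98 * ln ((real n)^2 + real n + 13 / 45) + c1 (1 / 2)
       \<and> (n \<noteq> 1 \<longrightarrow> harm n < 2 / 49 * ln ((real n)^2 + real n + 5 / 6)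
           + 45 / 98 * ln ((real n)^2 + real n + 13 / 45) + c1 (1 / 2)))
    \<and> c1 (1 / 2) = 1 - 2 / 49 * ln (17 / 6) - 45 / 98 * ln (103 / 45)
    \<and> \<bar>c1 (1 / 2) - 0.57726\<bar> < 0.000005"
proof (intro conjI allI impI)
  show "0.512967071402 \<le> a0" "a0 < 0.512967071403" using a0_bounds by simp_all
next
  fix a :: real and n :: nat
  assume "1 / 15 < a \<and> a < a0" and n: "n \<ge> 1"
  then have a: "1 / 15 < a" "a < 0.513" using a0_bounds(2) by simp_all
  show "L (real n) a + euler_mascheroni < harm n" "harm n \<le> L (real n) a + c1 a"
    "n \<noteq> 1 \<Longrightarrow> harm n < L (real n) a + c1 a"
    using harm_bounds[OF a n] by blast+
next
  fix a c :: real
  assume a: "1 / 15 < a \<and> a < a0" and c: "\<forall>n\<ge>1. L (real n) a + c < harm n"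
  \<comment> \<open>\<open>euler_mascheroni\<close> is the limit of \<open>harm n - L n a\<close>, so no larger constant can stay below
    this sequence.\<close>
  show "c \<le> euler_mascheroni"
  proof (rule LIMSEQ_le_const[OF harm_minus_L_tendsto])
    show "\<exists>N. \<forall>n\<ge>N. c \<le> harm n - L (real n) a"
      using c by (auto intro!: exI[of _ 1] less_imp_le simp: less_diff_eq add.commute)
  qed (use a in simp)
next
  fix a c :: real
  assume "\<forall>n\<ge>1. harm n \<le> L (real n) a + c"
  from this[rule_format, of 1] show "c1 a \<le> c" by (simp add: c1_def harm_def)
next
  fix n :: nat assume n: "n \<ge> 1"
  have L: "L x (1 / 2) = 2 / 49 * ln (x^2 + x + 5 / 6) + 45 / 98 * ln (x^2 + x + 13 / 45)" for x
    by (simp add: L_def power2_eq_square)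
  show "2 / 49 * ln ((real n)^2 + real n + 5 / 6)
      + 45 / 98 * ln ((real n)^2 + real n + 13 / 45) + euler_mascheroni < harm n"
    "harm n \<le> 2 / 49 * ln ((real n)^2 + real n + 5 / 6)
      + 45 / 98 * ln ((real n)^2 + real n + 13 / 45) + c1 (1 / 2)"
    "n \<noteq> 1 \<Longrightarrow> harm n < 2 / 49 * ln ((real n)^2 + real n + 5 / 6)
      + 45 / 98 * ln ((real n)^2 + real n + 13 / 45) + c1 (1 / 2)"
    using harm_bounds[of "1 / 2" n] n unfolding L by simp_all
next
  show "c1 (1 / 2) = 1 - 2 / 49 * ln (17 / 6) - 45 / 98 * ln (103 / 45)" by (rule c1_half)
  show "\<bar>c1 (1 / 2) - 0.57726\<bar> < 0.000005" by (rule c1_half_approx)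
qed

end
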